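(* Let $R$ be a GCD domain, let $(G,\alpha)$ be an edge labeled graph with $n$ vertices $v_1,\dots,v_n$ and edge labels in $R$, and let $F_1,F_2,\dots,F_n\in R_{(G,\alpha)}$. Then $Q_G$ divides $\big| F_1 \ F_2 \ \cdots \ F_n \big|$.
   Context: A GCD domain is an integral domain in which any two elements have a greatest common divisor. Gcds and lcms are defined up to units. $G$ is a finite simple graph with ordered vertex set $V(G)=\{v_1,\dots,v_n\}$ and edge set $E(G)$. An edge labeling $\alpha$ assigns to each edge $uv$ a principal ideal of $R$; a chosen generator is denoted $l_{uv}$ and is also called the edge label. A (generalized) spline on $(G,\alpha)$ is a tuple $F=(F(v_1),\dots,F(v_n))\in R^n$ such that $l_{uv}$ divides $F(u)-F(v)$ for every edge $uv\in E(G)$. The set $R_{(G,\alpha)}$ of all splines is an $R$-module under componentwise operations. A trail is a sequence of vertices and edges, each edge joining the consecutive vertices, in which no edge is repeated. For $i>1$, a zero trail of $v_i$ is a trail in $G$ (with at least one edge) starting at $v_i$ and ending at some $v_j$ with $j<i$. For a trail $p$, $(p)$ denotes the gcd of the labels of its edges. For $i\ge 2$, $\mathscr{L}_i$ is the lcm of the elements $(p)$ over all zero trails $p$ of $v_i$ (with the empty lcm equal to $1$), and $\mathscr{L}_1=1$. Put $Q_G=\prod_{i=1}^n \mathscr{L}_i$. For $F_1,\dots,F_n\in R_{(G,\alpha)}$ (regarded as a list), $\big| F_1 \ F_2 \ \cdots \ F_n \big|$ is the determinant of the $n\times n$ matrix whose $k$-th column is $(F_k(v_n),\dots,F_k(v_2),F_k(v_1))^T$.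 *)

theory Defs
  imports "Jordan_Normal_Form.Determinant"
begin

section \<open>GCD domains\<close>

text \<open>
  Greatest common divisors and least common multiples are only determined up to units, so they
  are rendered as relations. The type class \<^class>\<open>ring_gcd\<close> would in addition fix a
  normalisation and a particular choice of gcds.
\<close>

definition is_gcd :: "'a :: comm_ring_1 set \<Rightarrow> 'a \<Rightarrow> bool" where
  "is_gcd S d \<longleftrightarrow> (\<forall>a\<in>S. d dvd a) \<and> (\<forall>c. (\<forall>a\<in>S. c dvd a) \<longrightarrow> c dvd d)"

definition is_lcm :: "'a :: comm_ring_1 set \<Rightarrow> 'a \<Rightarrow> bool" where
  "is_lcm S m \<longleftrightarrow> (\<forall>a\<in>S. a dvd m) \<and> (\<forall>c. (\<forall>a\<in>S. a dvd c) \<longrightarrow> m dvd c)"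

class gcd_domain = idom +
  assumes ex_gcd: "\<exists>d. d dvd a \<and> d dvd b \<and> (\<forall>c. c dvd a \<longrightarrow> c dvd b \<longrightarrow> c dvd d)"

subclass (in ring_gcd) gcd_domain
proof
  fix a b
  show "\<exists>d. d dvd a \<and> d dvd b \<and> (\<forall>c. c dvd a \<longrightarrow> c dvd b \<longrightarrow> c dvd d)"
    by (rule exI[of _ "gcd a b"]) simp
qed


section \<open>Splines on edge labeled graphs\<close>

text \<open>
  An edge is a two-element set of vertices. An edge labeling is given by the chosen generators
  \<open>l e\<close> of the principal ideals; its values outside the edge set are irrelevant.
\<close>

definition simple_graph :: "'v set \<Rightarrow> 'v set set \<Rightarrow> bool" where
  "simple_graph V E \<longleftrightarrow> finite V \<and> (\<forall>e\<in>E. e \<subseteq> V \<and> card e = 2)"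

text \<open>A spline is a function on vertices, of which only the values on the vertex set matter.\<close>

definition splines :: "'v set set \<Rightarrow> ('v set \<Rightarrow> 'a :: comm_ring_1) \<Rightarrow> ('v \<Rightarrow> 'a) set" where
  "splines E l = {F. \<forall>u w. {u, w} \<in> E \<longrightarrow> l {u, w} dvd F u - F w}"

text \<open>As the graph is simple, a trail is determined by its sequence of vertices.\<close>

fun trail_edges :: "'v list \<Rightarrow> 'v set list" where
  "trail_edges (x # y # xs) = {x, y} # trail_edges (y # xs)"
| "trail_edges _ = []"

definition trail :: "'v set \<Rightarrow> 'v set set \<Rightarrow> 'v list \<Rightarrow> bool" where
  "trail V E p \<longleftrightarrow>
     p \<noteq> [] \<and> set p \<subseteq> V \<and> set (trail_edges p) \<subseteq> E \<and> distinct (trail_edges p)"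

text \<open>
  In the following, \<open>v i\<close> for \<open>1 \<le> i \<le> n\<close> is the \<open>i\<close>-th vertex of the graph.
\<close>

definition zero_trail ::
  "'v set \<Rightarrow> 'v set set \<Rightarrow> (nat \<Rightarrow> 'v) \<Rightarrow> nat \<Rightarrow> 'v list \<Rightarrow> bool" where
  "zero_trail V E v i p \<longleftrightarrow>
     trail V E p \<and> trail_edges p \<noteq> [] \<and> hd p = v i \<and> (\<exists>j. 1 \<le> j \<and> j < i \<and> last p = v j)"

definition is_trail_gcd :: "('v set \<Rightarrow> 'a :: comm_ring_1) \<Rightarrow> 'v list \<Rightarrow> 'a \<Rightarrow> bool" where
  "is_trail_gcd l p d \<longleftrightarrow> is_gcd (l ` set (trail_edges p)) d"

text \<open>
  \<open>is_L V E v l i m\<close>: the element \<open>m\<close> is a possible value of \<open>\<L>\<^sub>i\<close>. The lcm is taken over all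
  values of the gcds of the zero trails, which makes no difference to taking it over one chosen
  gcd for each zero trail. If there is no zero trail, \<open>m\<close> is a unit.
\<close>

definition is_L ::
  "'v set \<Rightarrow> 'v set set \<Rightarrow> (nat \<Rightarrow> 'v) \<Rightarrow> ('v set \<Rightarrow> 'a :: comm_ring_1) \<Rightarrow> nat \<Rightarrow> 'a \<Rightarrow> bool" where
  "is_L V E v l i m \<longleftrightarrow>
     (if i = 1 then m = 1
      else is_lcm {d. \<exists>p. zero_trail V E v i p \<and> is_trail_gcd l p d} m)"

definition is_Q ::
  "'v set \<Rightarrow> 'v set set \<Rightarrow> (nat \<Rightarrow> 'v) \<Rightarrow> nat \<Rightarrow> ('v set \<Rightarrow> 'a :: comm_ring_1) \<Rightarrow> 'a \<Rightarrow> bool" where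
  "is_Q V E v n l q \<longleftrightarrow>
     (\<exists>L. (\<forall>i\<in>{1..n}. is_L V E v l i (L i)) \<and> q = (\<Prod>i=1..n. L i))"

text \<open>
  Matrix indices start at 0, so column \<open>k\<close> belongs to \<open>F\<^sub>k\<^sub>+\<^sub>1\<close> and row \<open>r\<close> to \<open>v\<^sub>n\<^sub>-\<^sub>r\<close>: the last
  vertex is in the first row.
\<close>

definition spline_matrix ::
  "nat \<Rightarrow> (nat \<Rightarrow> 'v) \<Rightarrow> (nat \<Rightarrow> 'v \<Rightarrow> 'a) \<Rightarrow> 'a mat" where
  "spline_matrix n v F = mat n n (\<lambda>(r, k). F (k + 1) (v (n - r)))"


section \<open>Existence\<close>

text \<open>In a GCD domain, the relations above always have a solution.\<close>

lemma ex_gcd_finite: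
  fixes S :: "'a :: gcd_domain set"
  assumes "finite S"
  shows "\<exists>d. is_gcd S d"
  using assms
proof induction
  case empty
  show ?case by (rule exI[of _ 0]) (simp add: is_gcd_def)
next
  case (insert a S)
  then obtain d where d: "is_gcd S d" by blast
  obtain e where "e dvd a" "e dvd d" "\<forall>c. c dvd a \<longrightarrow> c dvd d \<longrightarrow> c dvd e"
    using ex_gcd[of a d] by blast
  with d have "is_gcd (insert a S) e"
    unfolding is_gcd_def by (simp, meson dvd_trans)
  then show ?case ..
qed

lemma ex_lcm:
  fixes a b :: "'a :: gcd_domain"
  shows "\<exists>m. a dvd m \<and> b dvd m \<and> (\<forall>c. a dvd c \<longrightarrow> b dvd c \<longrightarrow> m dvd c)"
proof -
  obtain d where d: "d dvd a" "d dvd b" and gd: "\<And>c. c dvd a \<Longrightarrow> c dvd b \<Longrightarrow> c dvd d"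
    using ex_gcd[of a b] by blast
  show ?thesis
  proof (cases "d = 0")
    case True
    with d show ?thesis by auto
  next
    case False
    from d obtain x y where a: "a = d * x" and b: "b = d * y" by (elim dvdE)
    have "d * x * y dvd z" if az: "a dvd z" and bz: "b dvd z" for z
    proof (cases "z = 0")
      case False
      obtain e where e: "e dvd z * a" "e dvd z * b"
        and ge: "\<And>c. c dvd z * a \<Longrightarrow> c dvd z * b \<Longrightarrow> c dvd e"
        using ex_gcd[of "z * a" "z * b"] by blast
      have "z * d dvd e"
        using d by (intro ge mult_dvd_mono dvd_refl)
      then obtain t where t: "e = z * d * t" by (elim dvdE)
      have "d * t dvd a" "d * t dvd b"
        using e False unfolding t mult.assoc by simp_all
      then have "d * t dvd d" by (rule gd)
      then have "e dvd z * d"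
        unfolding t mult.assoc by (intro mult_dvd_mono dvd_refl)
      have "b * a dvd z * a" "a * b dvd z * b"
        by (rule mult_dvd_mono[OF bz dvd_refl], rule mult_dvd_mono[OF az dvd_refl])
      then have "a * b dvd e"
        by (intro ge) (simp_all only: mult.commute[of b a])
      then have "a * b dvd z * d"
        using \<open>e dvd z * d\<close> by (rule dvd_trans)
      then have "d * (d * x * y) dvd d * z"
        unfolding a b by (simp only: mult_ac)
      with \<open>d \<noteq> 0\<close> show ?thesis by simp
    qed simp
    moreover have "a dvd d * x * y" "b dvd d * x * y"
      unfolding a b by simp_all
    ultimately show ?thesis by (intro exI[of _ "d * x * y"]) simp
  qed
qed

lemma ex_lcm_finite:
  fixes S :: "'a :: gcd_domain set"
  assumes "finite S"
  shows "\<exists>m. is_lcm S m"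
  using assms
proof induction
  case empty
  show ?case by (rule exI[of _ 1]) (simp add: is_lcm_def)
next
  case (insert a S)
  then obtain m where m: "is_lcm S m" by blast
  obtain k where "a dvd k" "m dvd k" "\<forall>c. a dvd c \<longrightarrow> m dvd c \<longrightarrow> k dvd c"
    using ex_lcm[of a m] by blast
  with m have "is_lcm (insert a S) k"
    unfolding is_lcm_def by (simp, meson dvd_trans)
  then show ?case ..
qed

lemma length_trail_edges: "length (trail_edges p) = length p - 1"
  by (induction p rule: trail_edges.induct) auto

lemma finite_trails:
  assumes "simple_graph V E"
  shows "finite {p. trail V E p}"
proof (rule finite_subset)
  have V: "finite V" and "E \<subseteq> Pow V" using assms unfolding simple_graph_def by auto
  then have E: "finite E" by (meson finite_Pow_iff finite_subset)
  show "{p. trail V E p} \<subseteq> {p. set p \<subseteq> V \<and> length p \<le> card E + 1}"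
  proof safe
    fix p assume p: "trail V E p"
    then have "length (trail_edges p) \<le> card E"
      using E unfolding trail_def by (metis card_mono distinct_card)
    then show "length p \<le> card E + 1" by (simp add: length_trail_edges)
  qed (auto simp: trail_def)
  show "finite {p. set p \<subseteq> V \<and> length p \<le> card E + 1}"
    using V by (rule finite_lists_length_le)
qed

lemma ex_L:
  fixes l :: "'v set \<Rightarrow> 'a :: gcd_domain"
  assumes "simple_graph V E"
  shows "\<exists>m. is_L V E v l i m"
proof -
  define Z where "Z = {p. zero_trail V E v i p}"
  have "finite Z"
    using finite_trails[OF assms] unfolding Z_def zero_trail_def
    by (rule rev_finite_subset) auto
  have "\<forall>p. \<exists>d. is_trail_gcd l p d"
    unfolding is_trail_gcd_def by (simp add: ex_gcd_finite)
  then obtain g where g: "\<And>p. is_trail_gcd l p (g p)" by metis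
  obtain m where m: "is_lcm (g ` Z) m"
    using ex_lcm_finite \<open>finite Z\<close> by blast
  have "d dvd g p" "g p dvd d" if "is_trail_gcd l p d" for p d
    using g[of p] that unfolding is_trail_gcd_def is_gcd_def by auto
  with m g have "is_lcm {d. \<exists>p. zero_trail V E v i p \<and> is_trail_gcd l p d} m"
    unfolding is_lcm_def Z_def by simp (meson dvd_trans)
  then show ?thesis by (auto simp: is_L_def)
qed

lemma ex_Q:
  fixes l :: "'v set \<Rightarrow> 'a :: gcd_domain"
  assumes "simple_graph V E"
  shows "\<exists>q. is_Q V E v n l q"
proof -
  have "\<forall>i. \<exists>m. is_L V E v l i m"
    using ex_L[OF assms] by blast
  then obtain L where "\<forall>i. is_L V E v l i (L i)"
    by (rule choice[THEN exE])
  then have "is_Q V E v n l (\<Prod>i=1..n. L i)"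
    unfolding is_Q_def by (intro exI[of _ L]) simp
  then show ?thesis ..
qed

end

theory Submission
  imports Defs
begin

text \<open>
  If \<open>d\<close> is the gcd of a zero trail from \<open>v\<^sub>i\<close> to \<open>v\<^sub>j\<close>, then \<open>d\<close> divides \<open>F(v\<^sub>i) - F(v\<^sub>j)\<close> for every
  spline \<open>F\<close>. Choosing one zero trail for each \<open>i\<close> and subtracting row \<open>v\<^sub>j\<close> from row \<open>v\<^sub>i\<close>, we see
  that the product of the chosen gcds divides the determinant. Multiplication by a fixed element
  commutes with lcms, so \<open>Q\<^sub>G\<close> is the lcm of these products over all choices of trails, and hence
  divides the determinant as well.
\<close>

text \<open>Since \<open>S\<close> is nonempty, \<open>c\<close> divides \<open>x\<close>. For
  nonzero \<open>c\<close>, cancelling it turns the quotient into a common multiple of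
  \<open>S\<close>, hence a multiple of \<open>m\<close>.\<close>

lemma is_lcm_mult_dvd:
  fixes c :: "'a :: idom"
  assumes "is_lcm S m" and "S \<noteq> {}" and "\<And>a. a \<in> S \<Longrightarrow> c * a dvd x"
  shows "c * m dvd x"
proof (cases "c = 0")
  case True
  with assms(2,3) show ?thesis by auto
next
  case False
  obtain a where "c * a dvd x" using assms(2,3) by blast
  then obtain y where x: "x = c * y" by (metis dvdE mult.assoc)
  have "\<forall>a\<in>S. a dvd y" using assms(3) False unfolding x by auto
  then have "m dvd y" using assms(1) unfolding is_lcm_def by blast
  then show ?thesis unfolding x by (rule mult_dvd_mono[OF dvd_refl])
qed

text \<open>The chosen elements are replaced by lcms one index at a time. The factor
  \<open>c\<close> is arbitrary so that the induction can absorb into it the element chosen at the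
  new index.\<close>

lemma mult_prod_lcm_dvd:
  fixes c :: "'a :: idom"
  assumes "finite I"
    and "\<And>i. i \<in> I \<Longrightarrow> is_lcm (S i) (m i)" and "\<And>i. i \<in> I \<Longrightarrow> S i \<noteq> {}"
    and "\<And>f. (\<And>i. i \<in> I \<Longrightarrow> f i \<in> S i) \<Longrightarrow> c * (\<Prod>i\<in>I. f i) dvd x"
  shows "c * (\<Prod>i\<in>I. m i) dvd x"
  using assms
proof (induction I arbitrary: c rule: finite_induct)
  case empty
  show ?case using empty.prems(3)[of "\<lambda>_. 0"] by simp
next
  case (insert j I)
  have "(c * (\<Prod>i\<in>I. m i)) * m j dvd x"
  proof (rule is_lcm_mult_dvd)
    show "is_lcm (S j) (m j)" "S j \<noteq> {}" using insert.prems by auto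
    fix a assume a: "a \<in> S j"
    have "(c * a) * (\<Prod>i\<in>I. m i) dvd x"
    proof (rule insert.IH)
      fix f assume f: "\<And>i. i \<in> I \<Longrightarrow> f i \<in> S i"
      have "(\<Prod>i\<in>I. (f(j := a)) i) = (\<Prod>i\<in>I. f i)"
        using insert.hyps by (intro prod.cong) auto
      moreover have "c * (\<Prod>i\<in>insert j I. (f(j := a)) i) dvd x"
        using f a by (intro insert.prems(3)) auto
      ultimately show "c * a * (\<Prod>i\<in>I. f i) dvd x"
        using insert.hyps by (simp add: mult.assoc)
    qed (use insert.prems in auto)
    then show "c * (\<Prod>i\<in>I. m i) * a dvd x" by (simp only: mult_ac)
  qed
  with insert.hyps show ?case by (simp add: mult_ac)
qed

lemma is_lcm_insert_1: "is_lcm (insert 1 S) m \<longleftrightarrow> is_lcm S m"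
  unfolding is_lcm_def by simp

text \<open>Adding multiples of lower rows to row \<open>r\<close> is left multiplication by a
  unitriangular matrix, so the determinant is unchanged, while row \<open>r\<close> becomes
  divisible by \<open>d r\<close>.\<close>

lemma prod_dvd_det:
  fixes A :: "'a :: comm_ring_1 mat"
  assumes A: "A \<in> carrier_mat n n"
    and dvd: "\<And>r k. r < n \<Longrightarrow> k < n \<Longrightarrow> d r dvd A $$ (r, k) + (\<Sum>s\<in>{r<..<n}. u r s * A $$ (s, k))"
  shows "(\<Prod>r<n. d r) dvd det A"
proof -
  define U where "U = mat n n (\<lambda>(r, s). if s = r then 1 else if r < s then u r s else 0)"
  have U: "U \<in> carrier_mat n n" unfolding U_def by simp
  have "upper_triangular U" unfolding U_def by auto
  then have "det U = prod_list (diag_mat U)" using U by (rule det_upper_triangular)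
  also have "diag_mat U = map (\<lambda>_. 1) [0..<n]"
    unfolding diag_mat_def U_def by simp
  finally have "det U = 1" by (simp add: map_replicate_const)
  then have det: "det A = det (U * A)" by (simp add: det_mult[OF U A])
  have UA: "(U * A) $$ (r, k) = A $$ (r, k) + (\<Sum>s\<in>{r<..<n}. u r s * A $$ (s, k))"
    if "r < n" "k < n" for r k
  proof -
    have "(U * A) $$ (r, k) = (\<Sum>s\<in>{0..<n}. U $$ (r, s) * A $$ (s, k))"
      using that U A by (simp add: scalar_prod_def)
    also have "\<dots> = (\<Sum>s\<in>{r..<n}. U $$ (r, s) * A $$ (s, k))"
      using that by (intro sum.mono_neutral_right) (auto simp: U_def)
    also have "{r..<n} = insert r {r<..<n}" using that by auto
    also have "(\<Sum>s\<in>insert r {r<..<n}. U $$ (r, s) * A $$ (s, k)) =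
        A $$ (r, k) + (\<Sum>s\<in>{r<..<n}. U $$ (r, s) * A $$ (s, k))"
      using that by (simp add: U_def)
    also have "(\<Sum>s\<in>{r<..<n}. U $$ (r, s) * A $$ (s, k)) =
        (\<Sum>s\<in>{r<..<n}. u r s * A $$ (s, k))"
      using that by (intro sum.cong) (auto simp: U_def)
    finally show ?thesis .
  qed
  have "U * A \<in> carrier_mat n n" using U A by simp
  \<comment> \<open>Each term of the Leibniz expansion contains exactly one entry from every row, so
    it is divisible by the whole product.\<close>
  from det_def'[OF this] show ?thesis
    unfolding det
    by (auto simp: UA permutes_in_image lessThan_atLeast0 intro!: dvd_sum dvd_mult prod_dvd_prod dvd)
qed

text \<open>The differences of \<open>F\<close> along consecutive edges telescope, and
  \<open>d\<close> divides each of them.\<close>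

lemma spline_dvd_trail:
  assumes "F \<in> splines E l" and "set (trail_edges p) \<subseteq> E" and "p \<noteq> []"
    and "\<And>e. e \<in> set (trail_edges p) \<Longrightarrow> d dvd l e"
  shows "d dvd F (hd p) - F (last p)"
  using assms(2-4)
proof (induction p rule: trail_edges.induct)
  case (1 x y xs)
  have "d dvd F x - F y"
    using 1(2,4) assms(1) unfolding splines_def by (auto intro: dvd_trans)
  moreover have "d dvd F y - F (last (y # xs))" using 1 by auto
  ultimately show ?case using dvd_add by fastforce
qed simp_all

theorem theorem3p3:
  fixes V :: "'v set" and E :: "'v set set" and v :: "nat \<Rightarrow> 'v" and n :: nat
    and l :: "'v set \<Rightarrow> 'a :: gcd_domain" and F :: "nat \<Rightarrow> 'v \<Rightarrow> 'a" and Q :: 'a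
  assumes "simple_graph V E"
    and "bij_betw v {1..n} V"
    and "\<And>k. k \<in> {1..n} \<Longrightarrow> F k \<in> splines E l"
    and "is_Q V E v n l Q"
  shows "Q dvd det (spline_matrix n v F)"
proof -
  let ?A = "spline_matrix n v F"
  obtain L where L: "\<And>i. i \<in> {1..n} \<Longrightarrow> is_L V E v l i (L i)" and Q: "Q = (\<Prod>i=1..n. L i)"
    using assms(4) unfolding is_Q_def by blast
  \<comment> \<open>The element 1 does not change the lcm, but it makes a choice possible when there is no zero trail.\<close>
  define S where
    "S i = insert 1 (if i = 1 then {} else {d. \<exists>p. zero_trail V E v i p \<and> is_trail_gcd l p d})" for i
  have "1 * (\<Prod>i=1..n. L i) dvd det ?A"
  proof (rule mult_prod_lcm_dvd)
    show "is_lcm (S i) (L i)" if "i \<in> {1..n}" for i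
      using L[OF that] unfolding is_L_def S_def is_lcm_insert_1
      by (auto simp: is_lcm_def split: if_splits)
    show "S i \<noteq> {}" for i unfolding S_def by simp
    fix d assume d: "\<And>i. i \<in> {1..n} \<Longrightarrow> d i \<in> S i"
    have "\<exists>u. \<forall>k<n. d (n - r) dvd ?A $$ (r, k) + (\<Sum>s\<in>{r<..<n}. u s * ?A $$ (s, k))"
      if r: "r < n" for r
    \<comment> \<open>For the value 1 any \<open>u\<close> works; every other value is the gcd of a
      zero trail.\<close>
    proof (cases "d (n - r) = 1")
      case False
      have "d (n - r) \<in> S (n - r)" using r by (intro d) auto
      with False obtain p where p: "zero_trail V E v (n - r) p" "is_trail_gcd l p (d (n - r))"
        unfolding S_def by (cases "n - r = 1") auto
      then obtain j where j: "1 \<le> j" "j < n - r" "last p = v j" and hd: "hd p = v (n - r)"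
        unfolding zero_trail_def by blast
      \<comment> \<open>The vertex \<open>v j\<close> has row \<open>n - j\<close>. As
        \<open>1 \<le> j\<close> and \<open>j < n - r\<close>, this row lies strictly below row
        \<open>r\<close>, so it may be subtracted.\<close>
      have "d (n - r) dvd ?A $$ (r, k) + (\<Sum>s\<in>{r<..<n}. (if s = n - j then - 1 else 0) * ?A $$ (s, k))"
        if k: "k < n" for k
      proof -
        have "d (n - r) dvd F (k + 1) (hd p) - F (k + 1) (last p)"
          using p k unfolding zero_trail_def trail_def is_trail_gcd_def is_gcd_def
          by (intro spline_dvd_trail[OF assms(3)]) auto
        moreover have "(\<Sum>s\<in>{r<..<n}. (if s = n - j then - 1 else 0) * ?A $$ (s, k)) =
            (\<Sum>s\<in>{r<..<n}. if s = n - j then - ?A $$ (n - j, k) else 0)"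
          by (intro sum.cong) auto
        ultimately show ?thesis using r k j hd by (auto simp: spline_matrix_def sum.delta)
      qed
      then show ?thesis by (intro exI[of _ "\<lambda>s. if s = n - j then - 1 else 0"]) blast
    qed simp
    then obtain u where
      "\<And>r k. r < n \<Longrightarrow> k < n \<Longrightarrow>
        d (n - r) dvd ?A $$ (r, k) + (\<Sum>s\<in>{r<..<n}. u r s * ?A $$ (s, k))"
      by metis
    then have "(\<Prod>r<n. d (n - r)) dvd det ?A"
      by (intro prod_dvd_det) (auto simp: spline_matrix_def)
    also have "(\<Prod>r<n. d (n - r)) = (\<Prod>i=1..n. d i)"
      by (rule prod.reindex_bij_witness[of _ "\<lambda>i. n - i" "\<lambda>r. n - r"]) auto
    finally show "1 * (\<Prod>i=1..n. d i) dvd det ?A" by simp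
  qed simp
  then show ?thesis unfolding Q by simp
qed

end
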